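(* Let $f(\cdot;i):\mathbb{R}^d\to\mathbb{R}$, $i\in[n]$, and $F(w)=\frac1n\sum_{i=1}^n f(w;i)$. Assume: (a) $\mathrm{dom}(F)\neq\emptyset$ and $F_*:=\inf_{w\in\mathbb{R}^d}F(w)>-\infty$; (b) there is $L>0$ such that for every $i\in[n]$ and all $w,w'\in\mathrm{dom}(F)$, $\|\nabla f(w;i)-\nabla f(w';i)\|\le L\|w-w'\|$; (c) there are finite constants $\Theta,\sigma\ge 0$ such that for all $w\in\mathrm{dom}(F)$, $\frac1n\sum_{i=1}^n\|\nabla f(w;i)-\nabla F(w)\|^2\le\Theta\|\nabla F(w)\|^2+\sigma^2$. Let $0\le\beta<1$ and $K:=\max\left\{\frac52,\frac{9(5-3\beta)(\Theta+1)}{1-\beta}\right\}$. Given an epoch budget $T\ge1$ and constants $\gamma>0$, $\rho>0$ with $\alpha:=\rho^{1/T}\in(0,1)$, run the SMG algorithm (described in the context), with any choice of permutations $\pi^{(t)}$, momentum weight $\beta$, and the exponential learning rate $\eta_t:=\frac{\gamma\alpha^t}{T^{1/3}}$, assumed to satisfy $0<\eta_t\le\frac{1}{L\sqrt K}$ for all $t$. Then $$\mathbb{E}\big[\|\nabla F(\hat w_T)\|^2\big]\le\frac{4[F(\tilde w_0)-F_*]}{(1-\beta)\gamma\rho T^{2/3}}+\frac{9\sigma^2L^2(5-3\beta)\gamma^2}{(1-\beta)\rho T^{2/3}}.$$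
   Context: $[n]=\{1,\dots,n\}$; $\|\cdot\|$ is the Euclidean norm; $\mathbb{E}$ is expectation over all randomness (permutations, if random, and output). Since each $f(\cdot;i)$ is real-valued on $\mathbb{R}^d$, $\mathrm{dom}(F)=\mathbb{R}^d$; each $f(\cdot;i)$ is differentiable. SMG algorithm (Shuffling Momentum Gradient), with parameters $\beta$, number of epochs $T\ge1$, and $\eta_t$: Choose $\tilde w_0\in\mathbb{R}^d$ (deterministic) and set $\tilde m_0:=0$. For $t=1,\dots,T$: set $w_0^{(t)}:=\tilde w_{t-1}$, $m_0^{(t)}:=\tilde m_{t-1}$, $v_0^{(t)}:=0$; generate an arbitrary deterministic or random permutation $\pi^{(t)}$ of $[n]$; for $i=0,\dots,n-1$ put $g_i^{(t)}:=\nabla f(w_i^{(t)};\pi^{(t)}(i+1))$ and $$m_{i+1}^{(t)}:=\beta m_0^{(t)}+(1-\beta)g_i^{(t)},\quad v_{i+1}^{(t)}:=v_i^{(t)}+\tfrac1n g_i^{(t)},\quad w_{i+1}^{(t)}:=w_i^{(t)}-\tfrac{\eta_t}{n}m_{i+1}^{(t)};$$ then set $\tilde w_t:=w_n^{(t)}$ and $\tilde m_t:=v_n^{(t)}$. Output: $\hat w_T\in\{\tilde w_0,\dots,\tilde w_{T-1}\}$ chosen at random (independently of the permutations) with probability $\mathbb{P}[\hat w_T=\tilde w_{t-1}]=\eta_t/\sum_{s=1}^T\eta_s$. *)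

theory Defs
  imports "HOL-Probability.Probability" "HOL-Combinatorics.Permutations"
begin

definition gradient :: "('a::real_inner \<Rightarrow> real) \<Rightarrow> 'a \<Rightarrow> 'a" where
  "gradient g x = (THE D. GDERIV g x :> D)"

lemma GDERIV_gradient:
  fixes g :: "'a::euclidean_space \<Rightarrow> real"
  assumes "g differentiable (at x)"
  shows "GDERIV g x :> gradient g x"
proof -
  obtain g' where g': "(g has_derivative g') (at x)"
    using assms by (auto simp: differentiable_def)
  then have "bounded_linear g'" by (rule has_derivative_bounded_linear)
  then have lin: "linear g'" by (rule bounded_linear.linear)
  define D where "D = (\<Sum>b\<in>Basis. g' b *\<^sub>R b)"
  have "g' = (\<lambda>h. inner h D)"
  proof
    fix h
    have "g' h = g' (\<Sum>b\<in>Basis. inner h b *\<^sub>R b)"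
      by (simp add: euclidean_representation)
    also have "\<dots> = (\<Sum>b\<in>Basis. inner h b * g' b)"
      by (simp add: linear_sum[OF lin] linear_scale[OF lin])
    also have "\<dots> = inner h D"
      by (simp add: D_def inner_sum_right mult.commute)
    finally show "g' h = inner h D" .
  qed
  with g' have D: "GDERIV g x :> D" by (simp add: gderiv_def)
  have "E = D" if "GDERIV g x :> E" for E
  proof -
    have "(\<lambda>h. inner h E) = (\<lambda>h. inner h D)"
      using that D unfolding gderiv_def by (rule has_derivative_unique)
    then have "inner h (E - D) = 0" for h
      by (simp add: inner_diff_right fun_eq_iff)
    then show ?thesis using inner_eq_zero_iff[of "E - D"] by simp
  qed
  with D show ?thesis unfolding gradient_def by (rule theI)
qed

definition objective :: "nat \<Rightarrow> ('a \<Rightarrow> nat \<Rightarrow> real) \<Rightarrow> 'a \<Rightarrow> real" where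
  "objective n f w = (1 / real n) * (\<Sum>i=1..n. f w i)"

text \<open>State \<open>(w\<^sub>i, v\<^sub>i)\<close> after \<open>i\<close> inner steps of one epoch with permutation \<open>p\<close> and
  learning rate \<open>\<eta>\<close>, started at \<open>w0\<close> with momentum \<open>m0\<close>.  The momentum \<open>m0\<close> is kept
  fixed throughout the epoch, so \<open>m\<^sub>i\<close> need not be part of the state.\<close>

primrec smg_inner ::
  "nat \<Rightarrow> ('a::real_inner \<Rightarrow> nat \<Rightarrow> real) \<Rightarrow> real \<Rightarrow> real \<Rightarrow> (nat \<Rightarrow> nat) \<Rightarrow> 'a \<Rightarrow> 'a \<Rightarrow> nat \<Rightarrow> 'a \<times> 'a"
where
  "smg_inner n f \<beta> \<eta> p w0 m0 0 = (w0, 0)"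
| "smg_inner n f \<beta> \<eta> p w0 m0 (Suc i) =
     (let (w, v) = smg_inner n f \<beta> \<eta> p w0 m0 i;
          g = gradient (\<lambda>x. f x (p (i + 1))) w;
          m = \<beta> *\<^sub>R m0 + (1 - \<beta>) *\<^sub>R g
      in (w - (\<eta> / real n) *\<^sub>R m, v + (1 / real n) *\<^sub>R g))"

text \<open>The pair of iterate and momentum after \<open>t\<close> epochs; epoch \<open>t\<close> uses \<open>\<eta> t\<close> and \<open>\<pi> t\<close>.\<close>

primrec smg_epoch ::
  "nat \<Rightarrow> ('a::real_inner \<Rightarrow> nat \<Rightarrow> real) \<Rightarrow> real \<Rightarrow> (nat \<Rightarrow> real) \<Rightarrow> (nat \<Rightarrow> nat \<Rightarrow> nat) \<Rightarrow> 'a \<Rightarrow> nat \<Rightarrow> 'a \<times> 'a"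
where
  "smg_epoch n f \<beta> \<eta> \<pi> w0 0 = (w0, 0)"
| "smg_epoch n f \<beta> \<eta> \<pi> w0 (Suc t) =
     (let (w, m) = smg_epoch n f \<beta> \<eta> \<pi> w0 t
      in smg_inner n f \<beta> (\<eta> (Suc t)) (\<pi> (Suc t)) w m n)"

definition smg_iterate ::
  "nat \<Rightarrow> ('a::real_inner \<Rightarrow> nat \<Rightarrow> real) \<Rightarrow> real \<Rightarrow> (nat \<Rightarrow> real) \<Rightarrow> (nat \<Rightarrow> nat \<Rightarrow> nat) \<Rightarrow> 'a \<Rightarrow> nat \<Rightarrow> 'a"
where
  "smg_iterate n f \<beta> \<eta> \<pi> w0 t = fst (smg_epoch n f \<beta> \<eta> \<pi> w0 t)"

definition smg_K :: "real \<Rightarrow> real \<Rightarrow> real" where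
  "smg_K \<beta> \<Theta> = max (5 / 2) (9 * (5 - 3 * \<beta>) * (\<Theta> + 1) / (1 - \<beta>))"

definition exp_rate :: "real \<Rightarrow> real \<Rightarrow> nat \<Rightarrow> nat \<Rightarrow> real" where
  "exp_rate \<gamma> \<alpha> T t = \<gamma> * \<alpha> ^ t / real T powr (1 / 3)"

abbreviation permutation_space :: "nat \<Rightarrow> (nat \<Rightarrow> nat) measure" where
  "permutation_space n \<equiv> count_space {p. p permutes {1..n}}"

end

theory Submission
  imports Defs
begin

text \<open>The estimate holds for every fixed sequence of permutations; randomness enters only through the
  output index. Write \<open>w t\<close> and \<open>m t\<close> for the iterate and the momentum after \<open>t\<close> epochs, and \<open>q t\<close> for
  the mean squared norm of the \<open>n\<close> stochastic gradients of epoch \<open>t\<close>, with \<open>q 0 = 0\<close>. One epoch is the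
  gradient-like step
  \<open>w (t+1) = w t - \<eta> (t+1) (\<beta> m t + (1 - \<beta>) m (t+1))\<close>, and \<open>m (t+1)\<close> is the average of the \<open>n\<close>
  component gradients, each taken at some inner iterate of that epoch.

  Since \<open>\<parallel>m t\<parallel>\<^sup>2 \<le> q t\<close>, any two inner iterates of epoch \<open>t + 1\<close> have squared distance at most
  \<open>\<eta> (t+1)\<^sup>2 (\<beta> q t + (1 - \<beta>) q (t+1))\<close> (\<open>smg_inner_distance\<close>). By the Lipschitz condition,
  \<open>m (t+1)\<close> is therefore close to the full gradient both at \<open>w t\<close> and at \<open>w (t+1)\<close>
  (\<open>momentum_error\<close>), and by the variance condition \<open>q (t+1)\<close> is at most twice
  \<open>(\<Theta> + 1) \<parallel>\<nabla>F (w t)\<parallel>\<^sup>2 + \<sigma>\<^sup>2\<close> plus a small multiple of \<open>\<beta> q t + (1 - \<beta>) q (t+1)\<close>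
  (\<open>mean_sq_bound\<close>). Inserting the momentum errors into the descent inequality of the smooth function
  \<open>F\<close> gives a recursion which is summed with the nonincreasing weights \<open>\<eta> t\<close>
  (\<open>descent_recursion_sum\<close>). With \<open>\<kappa> = (L \<eta> 1)\<^sup>2\<close> the step size condition yields
  \<open>18 \<kappa> (\<Theta> + 1) \<le> 1 - \<beta>\<close>, so the errors absorb only part of the descent, and
  \<open>(1 - \<beta>) / 4 * (\<Sum> \<eta> t \<parallel>\<nabla>F (w (t-1))\<parallel>\<^sup>2) \<le> F w0 - inf F + 9/8 \<kappa> \<sigma>\<^sup>2 (\<Sum> \<eta> t)\<close>
  (\<open>weighted_gradient_sum\<close>).

  The output index is independent of the permutations and has weights proportional to \<open>\<eta> t\<close>, so the
  expectation is the normalised expectation of the left-hand sum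
  (\<open>expectation_independent_index\<close>). For the exponential rate \<open>\<alpha> ^ T = \<rho>\<close>, whence
  \<open>\<Sum> \<eta> t \<ge> \<gamma> \<rho> (T powr (2/3))\<close> and \<open>\<kappa> \<le> L\<^sup>2 \<gamma>\<^sup>2 / (T powr (2/3))\<close>; the remaining
  numerical slack is absorbed by \<open>\<rho> \<le> 1\<close> and \<open>5 - 3 \<beta> \<ge> 2\<close>.\<close>

section \<open>Gradients and averages of vectors\<close>

lemma gradient_eqI:
  fixes g :: "'a::euclidean_space \<Rightarrow> real"
  assumes "GDERIV g x :> D"
  shows "gradient g x = D"
proof -
  have "g differentiable (at x)"
    using assms unfolding gderiv_def differentiable_def by blast
  then have "(\<lambda>h. inner h (gradient g x)) = (\<lambda>h. inner h D)"
    using GDERIV_gradient assms unfolding gderiv_def by (blast intro: has_derivative_unique)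
  then have "inner (gradient g x - D) (gradient g x - D) = 0"
    by (simp only: inner_diff_right fun_eq_iff)
  then show ?thesis by simp
qed

lemma GDERIV_objective:
  fixes f :: "'a::euclidean_space \<Rightarrow> nat \<Rightarrow> real"
  assumes "\<And>i. i \<in> {1..n} \<Longrightarrow> (\<lambda>x. f x i) differentiable (at w)"
  shows "GDERIV (objective n f) w :> (1 / real n) *\<^sub>R (\<Sum>i=1..n. gradient (\<lambda>x. f x i) w)"
proof -
  have "((\<lambda>x. (1 / real n) * (\<Sum>i=1..n. f x i)) has_derivative
      (\<lambda>h. (1 / real n) * (\<Sum>i=1..n. inner h (gradient (\<lambda>x. f x i) w)))) (at w)"
    using GDERIV_gradient[OF assms] unfolding gderiv_def
    by (intro has_derivative_mult_right has_derivative_sum) auto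
  then show ?thesis
    unfolding gderiv_def objective_def[abs_def] by (simp add: inner_sum_right)
qed

text \<open>The quadratic upper bound for a function with Lipschitz gradient: the map
  \<open>s \<mapsto> F (x + s h) - s \<langle>\<nabla>F x, h\<rangle> - L s\<^sup>2 \<parallel>h\<parallel>\<^sup>2 / 2\<close> is nonincreasing on \<open>[0, 1]\<close>.\<close>

lemma lipschitz_gradient_upper_bound:
  fixes F :: "'a::euclidean_space \<Rightarrow> real"
  assumes diff: "\<And>w. F differentiable (at w)"
    and lip: "\<And>w w'. norm (gradient F w - gradient F w') \<le> L * norm (w - w')"
  shows "F (x + h) \<le> F x + inner h (gradient F x) + L / 2 * (norm h)\<^sup>2"
proof -
  define \<phi> where "\<phi> s = F (x + s *\<^sub>R h) - s * inner h (gradient F x) - L / 2 * s\<^sup>2 * (norm h)\<^sup>2"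
    for s :: real
  have "\<phi> 1 \<le> \<phi> 0"
  proof (rule DERIV_nonpos_imp_nonincreasing[where f = \<phi> and a = 0 and b = 1])
    fix s :: real assume s: "0 \<le> s" "s \<le> 1"
    define y where "y = inner h (gradient F (x + s *\<^sub>R h)) - inner h (gradient F x) - L * s * (norm h)\<^sup>2"
    have F': "(F has_derivative (\<lambda>k. inner k (gradient F (x + s *\<^sub>R h)))) (at (x + s *\<^sub>R h))"
      using GDERIV_gradient[OF diff] unfolding gderiv_def .
    have "((\<lambda>s. F (x + s *\<^sub>R h)) has_derivative
        (\<lambda>d. inner (d *\<^sub>R h) (gradient F (x + s *\<^sub>R h)))) (at s)"
      by (rule has_derivative_compose[where f = "\<lambda>s. x + s *\<^sub>R h" and g = F and s = UNIV, OF _ F']) (auto intro!: derivative_eq_intros)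
    then have "DERIV (\<lambda>s. F (x + s *\<^sub>R h)) s :> inner h (gradient F (x + s *\<^sub>R h))"
      unfolding has_field_derivative_def by (simp add: mult.commute[of _ "inner h _"] mult_commute_abs)
    then have "DERIV \<phi> s :> y"
      unfolding \<phi>_def[abs_def] y_def
      by (auto intro!: derivative_eq_intros simp: power2_eq_square)
    moreover have "y \<le> 0"
    proof -
      have "inner h (gradient F (x + s *\<^sub>R h) - gradient F x)
          \<le> norm h * norm (gradient F (x + s *\<^sub>R h) - gradient F x)"
        by (rule norm_cauchy_schwarz)
      also have "\<dots> \<le> norm h * (L * norm (s *\<^sub>R h))"
        using lip[of "x + s *\<^sub>R h" x] by (intro mult_left_mono) auto
      also have "\<dots> = L * s * (norm h)\<^sup>2"
        using s by (simp add: power2_eq_square)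
      finally show ?thesis
        by (simp add: y_def inner_diff_right)
    qed
    ultimately show "\<exists>y. DERIV \<phi> s :> y \<and> y \<le> 0" by blast
  qed simp
  then show ?thesis by (simp add: \<phi>_def)
qed

lemma norm_convex_combination_squared_le:
  fixes x y :: "'a::real_normed_vector"
  assumes "0 \<le> \<beta>" "\<beta> \<le> 1"
  shows "(norm (\<beta> *\<^sub>R x + (1 - \<beta>) *\<^sub>R y))\<^sup>2 \<le> \<beta> * (norm x)\<^sup>2 + (1 - \<beta>) * (norm y)\<^sup>2"
proof -
  have "norm (\<beta> *\<^sub>R x + (1 - \<beta>) *\<^sub>R y) \<le> \<beta> * norm x + (1 - \<beta>) * norm y"
    using norm_triangle_ineq[of "\<beta> *\<^sub>R x" "(1 - \<beta>) *\<^sub>R y"] assms by simp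
  then have "(norm (\<beta> *\<^sub>R x + (1 - \<beta>) *\<^sub>R y))\<^sup>2 \<le> (\<beta> * norm x + (1 - \<beta>) * norm y)\<^sup>2"
    by (rule power_mono) simp
  also have "\<dots> = \<beta> * (norm x)\<^sup>2 + (1 - \<beta>) * (norm y)\<^sup>2 - \<beta> * (1 - \<beta>) * (norm x - norm y)\<^sup>2"
    by (simp add: power2_eq_square algebra_simps)
  also have "\<dots> \<le> \<beta> * (norm x)\<^sup>2 + (1 - \<beta>) * (norm y)\<^sup>2"
    using assms by simp
  finally show ?thesis .
qed

lemma norm_add_squared_le:
  fixes x y :: "'a::real_normed_vector"
  shows "(norm (x + y))\<^sup>2 \<le> 2 * (norm x)\<^sup>2 + 2 * (norm y)\<^sup>2"
proof -
  have "(norm (x + y))\<^sup>2 \<le> (norm x + norm y)\<^sup>2"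
    by (intro power_mono norm_triangle_ineq) simp
  also have "\<dots> \<le> 2 * (norm x)\<^sup>2 + 2 * (norm y)\<^sup>2"
    using zero_le_power2[of "norm x - norm y"] by (simp add: power2_eq_square algebra_simps)
  finally show ?thesis .
qed

lemma norm_partial_average_squared_le:
  fixes g :: "'i \<Rightarrow> 'a::real_normed_vector"
  assumes "finite A" "S \<subseteq> A"
  shows "(norm ((1 / real (card A)) *\<^sub>R sum g S))\<^sup>2 \<le> (1 / real (card A)) * (\<Sum>i\<in>A. (norm (g i))\<^sup>2)"
proof (cases "A = {}")
  case False
  then have pos: "0 < real (card A)" using assms by (simp add: card_gt_0_iff)
  have "(norm (sum g S))\<^sup>2 \<le> (\<Sum>i\<in>S. norm (g i))\<^sup>2"
    by (intro power_mono norm_sum) simp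
  also have "\<dots> \<le> (\<Sum>i\<in>S. (norm (g i))\<^sup>2) * real (card S)"
    by (rule sum_squared_le_sum_of_squares)
  also have "\<dots> \<le> (\<Sum>i\<in>A. (norm (g i))\<^sup>2) * real (card A)"
    using assms by (intro mult_mono sum_mono2) (auto intro: card_mono sum_nonneg)
  finally show ?thesis
    using pos by (simp add: power_mult_distrib power2_eq_square field_simps)
qed (use assms in simp)

section \<open>One epoch\<close>

text \<open>The stochastic gradient evaluated at inner step \<open>i\<close> (counted from \<open>0\<close>) of an epoch
  started at \<open>w\<close> with momentum \<open>m\<close>.\<close>

definition smg_grad ::
  "nat \<Rightarrow> ('a::real_inner \<Rightarrow> nat \<Rightarrow> real) \<Rightarrow> real \<Rightarrow> real \<Rightarrow> (nat \<Rightarrow> nat) \<Rightarrow> 'a \<Rightarrow> 'a \<Rightarrow> nat \<Rightarrow> 'a"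
where
  "smg_grad n f \<beta> \<eta> p w m i =
     gradient (\<lambda>x. f x (p (i + 1))) (fst (smg_inner n f \<beta> \<eta> p w m i))"

text \<open>The mean squared norm of the stochastic gradients used in an epoch.\<close>

definition smg_mean_sq ::
  "nat \<Rightarrow> ('a::real_inner \<Rightarrow> nat \<Rightarrow> real) \<Rightarrow> real \<Rightarrow> real \<Rightarrow> (nat \<Rightarrow> nat) \<Rightarrow> 'a \<Rightarrow> 'a \<Rightarrow> real"
where
  "smg_mean_sq n f \<beta> \<eta> p w m =
     (1 / real n) * (\<Sum>i<n. (norm (smg_grad n f \<beta> \<eta> p w m i))\<^sup>2)"

lemma smg_mean_sq_nonneg: "0 \<le> smg_mean_sq n f \<beta> \<eta> p w m"
  by (simp add: smg_mean_sq_def sum_nonneg)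

lemma snd_smg_inner:
  "snd (smg_inner n f \<beta> \<eta> p w m i) = (1 / real n) *\<^sub>R (\<Sum>j<i. smg_grad n f \<beta> \<eta> p w m j)"
  by (induction i) (simp_all add: smg_grad_def split_beta Let_def scaleR_add_right add.commute)

lemma fst_smg_inner_diff:
  assumes "i \<le> j"
  shows "fst (smg_inner n f \<beta> \<eta> p w m i) - fst (smg_inner n f \<beta> \<eta> p w m j) =
    \<eta> *\<^sub>R (\<beta> *\<^sub>R ((real (j - i) / real n) *\<^sub>R m)
      + (1 - \<beta>) *\<^sub>R ((1 / real n) *\<^sub>R (\<Sum>k\<in>{i..<j}. smg_grad n f \<beta> \<eta> p w m k)))"
  using assms
proof (induction j rule: dec_induct)
  case (step j)
  let ?w = "\<lambda>i. fst (smg_inner n f \<beta> \<eta> p w m i)" and ?g = "smg_grad n f \<beta> \<eta> p w m"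
  have "?w i - ?w (Suc j) = (?w i - ?w j)
      + (\<eta> / real n) *\<^sub>R (\<beta> *\<^sub>R m + (1 - \<beta>) *\<^sub>R ?g j)"
    by (simp add: smg_grad_def split_beta Let_def)
  also have "\<dots> = \<eta> *\<^sub>R (\<beta> *\<^sub>R ((real (Suc j - i) / real n) *\<^sub>R m)
      + (1 - \<beta>) *\<^sub>R ((1 / real n) *\<^sub>R (\<Sum>k\<in>{i..<Suc j}. ?g k)))"
    unfolding step.IH using step.hyps
    by (simp add: Suc_diff_le sum.atLeastLessThan_Suc scaleR_add_right scaleR_add_left
        add_divide_distrib distrib_left distrib_right)
  finally show ?case .
qed simp

lemma sum_permutes_lessThan:
  fixes \<phi> :: "nat \<Rightarrow> 'b::comm_monoid_add"
  assumes "p permutes {1..n}"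
  shows "(\<Sum>j<n. \<phi> (p (j + 1))) = (\<Sum>i=1..n. \<phi> i)"
proof -
  have "(\<Sum>j<n. \<phi> (p (j + 1))) = (\<Sum>i=1..n. \<phi> (p i))"
    by (rule sum.reindex_bij_witness[of _ "\<lambda>i. i - 1" "\<lambda>j. j + 1"]) auto
  then show ?thesis using sum.permute[OF assms, of \<phi>] by (simp add: o_def)
qed

text \<open>A partial sum of the steps of an epoch, just as the full sum, is controlled by the incoming
  momentum and the mean squared stochastic gradient, whatever the order of the components.\<close>

lemma smg_inner_distance:
  assumes "0 \<le> \<beta>" "\<beta> \<le> 1" and n: "1 \<le> n" and ij: "i \<le> j" "j \<le> n"
  shows "(norm (fst (smg_inner n f \<beta> \<eta> p w m i) - fst (smg_inner n f \<beta> \<eta> p w m j)))\<^sup>2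
     \<le> \<eta>\<^sup>2 * (\<beta> * (norm m)\<^sup>2 + (1 - \<beta>) * smg_mean_sq n f \<beta> \<eta> p w m)"
proof -
  let ?g = "smg_grad n f \<beta> \<eta> p w m"
  let ?a = "(real (j - i) / real n) *\<^sub>R m"
    and ?b = "(1 / real n) *\<^sub>R (\<Sum>k\<in>{i..<j}. ?g k)"
  have "real (j - i) / real n \<le> 1" using ij n by simp
  then have "norm ?a \<le> norm m"
    using mult_right_mono[of "real (j - i) / real n" 1 "norm m"] by simp
  then have a: "(norm ?a)\<^sup>2 \<le> (norm m)\<^sup>2" by (rule power_mono) simp
  have b: "(norm ?b)\<^sup>2 \<le> smg_mean_sq n f \<beta> \<eta> p w m"
  proof -
    have "{i..<j} \<subseteq> {..<n}" using ij by auto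
    then show ?thesis
      using norm_partial_average_squared_le[of "{..<n}" "{i..<j}" ?g]
      by (simp add: smg_mean_sq_def)
  qed
  have "(norm (\<beta> *\<^sub>R ?a + (1 - \<beta>) *\<^sub>R ?b))\<^sup>2 \<le> \<beta> * (norm ?a)\<^sup>2 + (1 - \<beta>) * (norm ?b)\<^sup>2"
    using assms by (intro norm_convex_combination_squared_le) auto
  also have "\<dots> \<le> \<beta> * (norm m)\<^sup>2 + (1 - \<beta>) * smg_mean_sq n f \<beta> \<eta> p w m"
    using assms a b by (intro add_mono mult_left_mono) auto
  finally show ?thesis
    unfolding fst_smg_inner_diff[OF ij(1)] norm_scaleR power_mult_distrib
    by (simp add: mult_left_mono)
qed

lemma smg_epoch_step:
  assumes "1 \<le> n"
  shows "fst (smg_inner n f \<beta> \<eta> p w m n)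
     = w + (- \<eta>) *\<^sub>R (\<beta> *\<^sub>R m + (1 - \<beta>) *\<^sub>R snd (smg_inner n f \<beta> \<eta> p w m n))"
proof -
  have "w - fst (smg_inner n f \<beta> \<eta> p w m n)
      = \<eta> *\<^sub>R (\<beta> *\<^sub>R m + (1 - \<beta>) *\<^sub>R snd (smg_inner n f \<beta> \<eta> p w m n))"
    using fst_smg_inner_diff[of 0 n n f \<beta> \<eta> p w m] assms
    by (simp add: snd_smg_inner lessThan_atLeast0)
  then show ?thesis by (simp add: algebra_simps)
qed

lemma smg_momentum_bound:
  "(norm (snd (smg_inner n f \<beta> \<eta> p w m n)))\<^sup>2 \<le> smg_mean_sq n f \<beta> \<eta> p w m"
  using norm_partial_average_squared_le[of "{..<n}" "{..<n}" "smg_grad n f \<beta> \<eta> p w m"]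
  by (simp add: snd_smg_inner smg_mean_sq_def)

section \<open>A descent recursion\<close>

lemma sum_shift_antimono_le:
  fixes h a :: "nat \<Rightarrow> real"
  assumes "\<And>t. Suc t < T \<Longrightarrow> h (Suc t) \<le> h t" "\<And>t. t < T \<Longrightarrow> 0 \<le> h t"
    and "\<And>t. 0 \<le> a t" "a 0 = 0"
  shows "(\<Sum>t<T. h t * a t) \<le> (\<Sum>t<T. h t * a (Suc t))"
proof (cases T)
  case (Suc S)
  have "(\<Sum>t<Suc S. h t * a t) = (\<Sum>t<S. h (Suc t) * a (Suc t))"
    by (subst sum.lessThan_Suc_shift) (simp add: assms(4))
  also have "\<dots> \<le> (\<Sum>t<S. h t * a (Suc t))"
    using assms Suc by (intro sum_mono mult_right_mono) auto
  also have "\<dots> \<le> (\<Sum>t<Suc S. h t * a (Suc t))"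
    using assms Suc by simp
  finally show ?thesis using Suc by simp
qed simp

text \<open>Here \<open>\<Phi> t\<close> stands for the objective after \<open>t\<close> epochs, \<open>G t\<close> for the squared gradient norm, \<open>q t\<close>
  for the mean squared stochastic gradient of epoch \<open>t\<close>, and \<open>\<kappa> e t\<close> for the bound on the momentum
  error made in that epoch. Since \<open>h\<close> is nonincreasing, delayed errors may be charged to the epochs
  that produced them, so both sums of errors are at most \<open>\<Sum> h t q (t + 1)\<close>, which the last
  hypothesis bounds in terms of \<open>G\<close> and \<open>s\<close>.\<close>

lemma descent_recursion_sum:
  fixes h q e G \<Phi> :: "nat \<Rightarrow> real"
  assumes h: "\<And>t. t < T \<Longrightarrow> 0 \<le> h t" and anti: "\<And>t. Suc t < T \<Longrightarrow> h (Suc t) \<le> h t"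
    and q: "\<And>t. 0 \<le> q t" "q 0 = 0" and G: "\<And>t. 0 \<le> G t"
    and beta: "0 \<le> \<beta>" "\<beta> < 1" and Theta: "0 \<le> \<Theta>"
    and kappa: "0 \<le> \<kappa>" "18 * \<kappa> * (\<Theta> + 1) \<le> 1 - \<beta>"
    and e: "e 0 = 0" "\<And>t. e (Suc t) = \<beta> * q t + (1 - \<beta>) * q (Suc t)"
    and descent: "\<And>t. t < T \<Longrightarrow> \<Phi> (Suc t) \<le> \<Phi> t - (1 - \<beta>) / 2 * (h t * G t)
      + \<kappa> / 2 * (h t * (\<beta> * e t + (1 - \<beta>) * e (Suc t)))"
    and grow: "\<And>t. t < T \<Longrightarrow> q (Suc t) \<le> 2 * \<kappa> * e (Suc t) + 2 * ((\<Theta> + 1) * G t + s)"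
  shows "(1 - \<beta>) / 4 * (\<Sum>t<T. h t * G t) \<le> \<Phi> 0 - \<Phi> T + 9 / 8 * \<kappa> * s * (\<Sum>t<T. h t)"
proof -
  define S where "S = (\<Sum>t<T. h t * q (Suc t))"
  define E where "E = (\<Sum>t<T. h t * e (Suc t))"
  define E' where "E' = (\<Sum>t<T. h t * e t)"
  define \<Gamma> where "\<Gamma> = (\<Sum>t<T. h t * G t)"
  define H where "H = (\<Sum>t<T. h t)"
  have e_nonneg: "0 \<le> e t" for t
    using q beta e by (cases t) auto
  have S: "0 \<le> S" and Gamma: "0 \<le> \<Gamma>"
    unfolding S_def \<Gamma>_def using h q G by (auto intro!: sum_nonneg)
  have "E = \<beta> * (\<Sum>t<T. h t * q t) + (1 - \<beta>) * S"
    unfolding E_def S_def e by (simp add: algebra_simps sum.distrib sum_subtractf sum_distrib_left)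
  also have "\<dots> \<le> \<beta> * S + (1 - \<beta>) * S"
    unfolding S_def using sum_shift_antimono_le[of T h q] anti h q beta
    by (intro add_right_mono mult_left_mono) auto
  finally have E: "E \<le> S" by (simp add: algebra_simps)
  have "E' \<le> E"
    unfolding E_def E'_def using anti h e_nonneg e(1) by (rule sum_shift_antimono_le)
  then have E': "E' \<le> S" using E by simp

  have "18 * \<kappa> * 1 \<le> 18 * \<kappa> * (\<Theta> + 1)" using kappa Theta by (intro mult_left_mono) auto
  then have kappa_le: "\<kappa> \<le> 1 / 18" using kappa beta by simp
  have "S \<le> (\<Sum>t<T. h t * (2 * \<kappa> * e (Suc t) + 2 * ((\<Theta> + 1) * G t + s)))"
    unfolding S_def using h grow by (intro sum_mono mult_left_mono) auto
  also have "\<dots> = 2 * \<kappa> * E + 2 * ((\<Theta> + 1) * \<Gamma> + s * H)"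
    unfolding E_def \<Gamma>_def H_def by (simp add: algebra_simps sum.distrib sum_distrib_left)
  also have "2 * \<kappa> * E \<le> 2 * \<kappa> * S"
    using E kappa by (intro mult_left_mono) auto
  also have "2 * \<kappa> * S \<le> 1 / 9 * S"
    using kappa_le S by (intro mult_right_mono) auto
  finally have S_le: "S \<le> 9 / 4 * ((\<Theta> + 1) * \<Gamma> + s * H)" by simp

  have "\<beta> * E' + (1 - \<beta>) * E \<le> \<beta> * S + (1 - \<beta>) * S"
    using E E' beta by (intro add_mono mult_left_mono) auto
  also have "\<dots> = S" by (simp add: algebra_simps)
  also note S_le
  finally have "\<kappa> / 2 * (\<beta> * E' + (1 - \<beta>) * E) \<le> \<kappa> / 2 * (9 / 4 * ((\<Theta> + 1) * \<Gamma> + s * H))"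
    using kappa by (intro mult_left_mono) auto
  also have "\<dots> = 1 / 16 * (18 * \<kappa> * (\<Theta> + 1) * \<Gamma>) + 9 / 8 * \<kappa> * s * H"
    by (simp add: algebra_simps)
  also have "\<dots> \<le> 1 / 16 * ((1 - \<beta>) * \<Gamma>) + 9 / 8 * \<kappa> * s * H"
    by (intro add_right_mono mult_left_mono mult_right_mono kappa Gamma) simp
  finally have error: "\<kappa> / 2 * (\<beta> * E' + (1 - \<beta>) * E) \<le> 1 / 16 * ((1 - \<beta>) * \<Gamma>) + 9 / 8 * \<kappa> * s * H" .

  have "\<Phi> T - \<Phi> 0 = (\<Sum>t<T. \<Phi> (Suc t) - \<Phi> t)"
    by (simp add: sum_lessThan_telescope)
  also have "\<dots> \<le> (\<Sum>t<T. \<kappa> / 2 * (h t * (\<beta> * e t + (1 - \<beta>) * e (Suc t))) - (1 - \<beta>) / 2 * (h t * G t))"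
    using descent by (intro sum_mono) (simp add: algebra_simps)
  also have "\<dots> = \<kappa> / 2 * (\<beta> * E' + (1 - \<beta>) * E) - (1 - \<beta>) / 2 * \<Gamma>"
    unfolding E_def E'_def \<Gamma>_def
    by (simp only: distrib_left sum.distrib sum_subtractf sum_distrib_left mult.assoc mult.left_commute[of "h _"])
  also note error
  finally have "\<Phi> T - \<Phi> 0 \<le> 1 / 16 * ((1 - \<beta>) * \<Gamma>) + 9 / 8 * \<kappa> * s * H - (1 - \<beta>) / 2 * \<Gamma>"
    by simp
  moreover have "0 \<le> (1 - \<beta>) * \<Gamma>" using beta Gamma by simp
  ultimately show ?thesis unfolding \<Gamma>_def H_def by simp
qed

section \<open>Gradient and momentum errors for a smooth finite sum\<close>

text \<open>A finite sum of differentiable functions with uniformly Lipschitz gradients whose deviation from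
  the mean gradient satisfies the relaxed variance bound, stated for the mean \<open>objective n f\<close>.\<close>

locale smooth_finite_sum =
  fixes n :: nat and f :: "'a::euclidean_space \<Rightarrow> nat \<Rightarrow> real" and L \<Theta> \<sigma> :: real
  assumes n_pos: "1 \<le> n"
    and differentiable: "i \<in> {1..n} \<Longrightarrow> (\<lambda>x. f x i) differentiable (at w)"
    and lipschitz: "i \<in> {1..n} \<Longrightarrow>
      norm (gradient (\<lambda>x. f x i) w - gradient (\<lambda>x. f x i) w') \<le> L * norm (w - w')"
    and variance: "(1 / real n) * (\<Sum>i=1..n. (norm (gradient (\<lambda>x. f x i) w - gradient (objective n f) w))\<^sup>2)
      \<le> \<Theta> * (norm (gradient (objective n f) w))\<^sup>2 + \<sigma>\<^sup>2"
begin

abbreviation "obj \<equiv> objective n f"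

text \<open>The bound on the mean squared norm of the component gradients at one common point.\<close>

abbreviation "second_moment_bound w \<equiv> (\<Theta> + 1) * (norm (gradient obj w))\<^sup>2 + \<sigma>\<^sup>2"

lemma gradient_obj: "gradient obj w = (1 / real n) *\<^sub>R (\<Sum>i=1..n. gradient (\<lambda>x. f x i) w)"
  by (intro gradient_eqI GDERIV_objective differentiable)

lemma differentiable_obj: "obj differentiable (at w)"
  using GDERIV_objective[of n f w] differentiable unfolding gderiv_def differentiable_def by blast

lemma lipschitz_obj: "norm (gradient obj w - gradient obj w') \<le> L * norm (w - w')"
proof -
  have "norm (\<Sum>i=1..n. gradient (\<lambda>x. f x i) w - gradient (\<lambda>x. f x i) w')
      \<le> (\<Sum>i=1..n. L * norm (w - w'))"
    by (intro sum_norm_le lipschitz)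
  then have "norm (\<Sum>i=1..n. gradient (\<lambda>x. f x i) w - gradient (\<lambda>x. f x i) w') / real n
      \<le> L * norm (w - w')"
    using n_pos by (simp add: pos_divide_le_eq mult.commute)
  moreover have "gradient obj w - gradient obj w'
      = (1 / real n) *\<^sub>R (\<Sum>i=1..n. gradient (\<lambda>x. f x i) w - gradient (\<lambda>x. f x i) w')"
    by (simp add: gradient_obj sum_subtractf scaleR_diff_right)
  ultimately show ?thesis by simp
qed

lemma second_moment:
  "(1 / real n) * (\<Sum>i=1..n. (norm (gradient (\<lambda>x. f x i) w))\<^sup>2) \<le> second_moment_bound w"
proof -
  let ?h = "\<lambda>i. gradient (\<lambda>x. f x i) w" and ?G = "gradient obj w"
  have sum_h: "(\<Sum>i=1..n. ?h i) = real n *\<^sub>R ?G"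
    using n_pos by (simp add: gradient_obj)
  have "(\<Sum>i=1..n. (norm (?h i - ?G))\<^sup>2)
      = (\<Sum>i=1..n. (norm (?h i))\<^sup>2 - 2 * inner (?h i) ?G + (norm ?G)\<^sup>2)"
    by (simp add: power2_norm_eq_inner inner_diff_left inner_diff_right inner_commute algebra_simps)
  also have "\<dots> = (\<Sum>i=1..n. (norm (?h i))\<^sup>2) - 2 * inner (\<Sum>i=1..n. ?h i) ?G + real n * (norm ?G)\<^sup>2"
    by (simp add: sum.distrib sum_subtractf inner_sum_left sum_distrib_left)
  also have "\<dots> = (\<Sum>i=1..n. (norm (?h i))\<^sup>2) - real n * (norm ?G)\<^sup>2"
    unfolding sum_h by (simp add: power2_norm_eq_inner)
  finally have "(1 / real n) * (\<Sum>i=1..n. (norm (?h i))\<^sup>2)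
      = (1 / real n) * (\<Sum>i=1..n. (norm (?h i - ?G))\<^sup>2) + (norm ?G)\<^sup>2"
    using n_pos by (simp add: field_simps)
  then show ?thesis using variance[of w] by (simp add: algebra_simps)
qed

context
  fixes p :: "nat \<Rightarrow> nat" and \<beta> \<eta> :: real and w m :: 'a
  assumes perm: "p permutes {1..n}" and beta: "0 \<le> \<beta>" "\<beta> \<le> 1"
begin

text \<open>Inner iterates of the epoch, mean squared norm of its stochastic gradients, and the bound on
  the squared distance of any two of its iterates.\<close>

abbreviation (input) "iter \<equiv> \<lambda>i. fst (smg_inner n f \<beta> \<eta> p w m i)"
abbreviation (input) "msq \<equiv> smg_mean_sq n f \<beta> \<eta> p w m"
abbreviation (input) "spread \<equiv> \<eta>\<^sup>2 * (\<beta> * (norm m)\<^sup>2 + (1 - \<beta>) * msq)"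

lemma perm_in: "j < n \<Longrightarrow> p (j + 1) \<in> {1..n}"
  using permutes_in_image[OF perm, of "j + 1"] by auto

lemma component_gradient_error:
  assumes "k \<le> n" "j < n"
  shows "(norm (gradient (\<lambda>x. f x (p (j + 1))) (iter k) - smg_grad n f \<beta> \<eta> p w m j))\<^sup>2
    \<le> L\<^sup>2 * spread"
proof -
  have dist: "(norm (iter k - iter j))\<^sup>2 \<le> spread"
    using smg_inner_distance[OF beta n_pos, of k j f \<eta> p w m]
      smg_inner_distance[OF beta n_pos, of j k f \<eta> p w m] assms
    by (cases "k \<le> j") (auto simp: norm_minus_commute)
  have "(norm (gradient (\<lambda>x. f x (p (j + 1))) (iter k) - smg_grad n f \<beta> \<eta> p w m j))\<^sup>2
      \<le> (L * norm (iter k - iter j))\<^sup>2"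
    unfolding smg_grad_def using perm_in[OF assms(2)] by (intro power_mono lipschitz) auto
  also have "\<dots> \<le> L\<^sup>2 * spread"
    unfolding power_mult_distrib by (intro mult_left_mono dist) simp
  finally show ?thesis .
qed

text \<open>The momentum returned by an epoch approximates the full gradient at every iterate of that
  epoch; below this is used at its first and at its last iterate.\<close>

lemma momentum_error:
  assumes "k \<le> n"
  shows "(norm (gradient obj (iter k) - snd (smg_inner n f \<beta> \<eta> p w m n)))\<^sup>2 \<le> L\<^sup>2 * spread"
proof -
  let ?d = "\<lambda>j. gradient (\<lambda>x. f x (p (j + 1))) (iter k) - smg_grad n f \<beta> \<eta> p w m j"
  have "gradient obj (iter k) = (1 / real n) *\<^sub>R (\<Sum>j<n. gradient (\<lambda>x. f x (p (j + 1))) (iter k))"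
    unfolding gradient_obj
    using sum_permutes_lessThan[OF perm, of "\<lambda>i. gradient (\<lambda>x. f x i) (iter k)"] by simp
  then have "gradient obj (iter k) - snd (smg_inner n f \<beta> \<eta> p w m n) = (1 / real n) *\<^sub>R (\<Sum>j<n. ?d j)"
    by (simp add: snd_smg_inner sum_subtractf scaleR_diff_right)
  then have "(norm (gradient obj (iter k) - snd (smg_inner n f \<beta> \<eta> p w m n)))\<^sup>2
      \<le> (1 / real n) * (\<Sum>j<n. (norm (?d j))\<^sup>2)"
    using norm_partial_average_squared_le[of "{..<n}" "{..<n}" ?d] by simp
  also have "\<dots> \<le> (1 / real n) * (\<Sum>j<n. L\<^sup>2 * spread)"
    using component_gradient_error[OF assms] by (intro mult_left_mono sum_mono) auto
  also have "\<dots> = L\<^sup>2 * spread" using n_pos by simp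
  finally show ?thesis .
qed

lemma mean_sq_bound: "msq \<le> 2 * (L\<^sup>2 * spread) + 2 * second_moment_bound w"
proof -
  let ?h = "\<lambda>j. gradient (\<lambda>x. f x (p (j + 1))) w" and ?g = "smg_grad n f \<beta> \<eta> p w m"
  define c where "c = L\<^sup>2 * spread"
  have "(norm (?g j))\<^sup>2 \<le> 2 * c + 2 * (norm (?h j))\<^sup>2" if "j < n" for j
    unfolding c_def using norm_add_squared_le[of "?g j - ?h j" "?h j"] component_gradient_error[of 0 j] that
    by (simp add: norm_minus_commute)
  then have "msq \<le> (1 / real n) * (\<Sum>j<n. 2 * c + 2 * (norm (?h j))\<^sup>2)"
    unfolding smg_mean_sq_def by (intro mult_left_mono sum_mono) auto
  also have "\<dots> = 2 * c + 2 * ((1 / real n) * (\<Sum>j<n. (norm (?h j))\<^sup>2))"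
    using n_pos by (simp add: sum.distrib field_simps flip: sum_distrib_left)
  also have "\<dots> \<le> 2 * c + 2 * second_moment_bound w"
    using second_moment[of w]
      sum_permutes_lessThan[OF perm, of "\<lambda>i. (norm (gradient (\<lambda>x. f x i) w))\<^sup>2"] by simp
  finally show ?thesis unfolding c_def .
qed

end

lemma gradient_step_descent:
  assumes "0 \<le> \<eta>" "L * \<eta> \<le> 1"
  shows "obj (w + (- \<eta>) *\<^sub>R d)
    \<le> obj w - \<eta> / 2 * (norm (gradient obj w))\<^sup>2 + \<eta> / 2 * (norm (gradient obj w - d))\<^sup>2"
proof -
  have "obj (w + (- \<eta>) *\<^sub>R d)
      \<le> obj w + inner ((- \<eta>) *\<^sub>R d) (gradient obj w) + L / 2 * (norm ((- \<eta>) *\<^sub>R d))\<^sup>2"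
    by (intro lipschitz_gradient_upper_bound differentiable_obj lipschitz_obj)
  also have "\<dots> = obj w - \<eta> / 2 * (norm (gradient obj w))\<^sup>2 + \<eta> / 2 * (norm (gradient obj w - d))\<^sup>2
      - \<eta> / 2 * (1 - L * \<eta>) * (norm d)\<^sup>2"
  proof -
    have square: "(norm (gradient obj w - d))\<^sup>2 = (norm (gradient obj w))\<^sup>2 - 2 * inner d (gradient obj w) + (norm d)\<^sup>2"
      unfolding power2_norm_eq_inner by (simp add: inner_diff_left inner_diff_right inner_commute)
    show ?thesis
      unfolding square using assms
      by (simp add: power_mult_distrib power2_eq_square[of \<eta>] field_simps)
  qed
  also have "\<dots> \<le> obj w - \<eta> / 2 * (norm (gradient obj w))\<^sup>2 + \<eta> / 2 * (norm (gradient obj w - d))\<^sup>2"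
    using assms by simp
  finally show ?thesis .
qed


text \<open>The momentum carried into epoch \<open>t + 1\<close> is accurate to within the spread of epoch \<open>t\<close>, the
  one it carries out to within the spread of epoch \<open>t + 1\<close>; the update direction is a convex
  combination of the two. For \<open>t = 0\<close> the incoming momentum is \<open>0\<close> and carries no error, but the
  effective step is shortened by \<open>1 - \<beta>\<close>, which is the source of that factor in the
  conclusion.\<close>

lemma weighted_gradient_sum:
  fixes \<pi> :: "nat \<Rightarrow> nat \<Rightarrow> nat" and w0 :: 'a
  assumes perm: "\<And>t. t \<in> {1..T} \<Longrightarrow> \<pi> t permutes {1..n}"
    and beta: "0 \<le> \<beta>" "\<beta> < 1" and Theta: "0 \<le> \<Theta>"
    and eta: "\<And>t. t \<in> {1..T} \<Longrightarrow> 0 \<le> \<eta> t"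
    and eta_le: "\<And>t. t \<in> {1..T} \<Longrightarrow> (L * \<eta> t)\<^sup>2 \<le> \<kappa>"
    and eta_anti: "\<And>t. t \<in> {1..<T} \<Longrightarrow> \<eta> (Suc t) \<le> \<eta> t"
    and kappa: "0 \<le> \<kappa>" "18 * \<kappa> * (\<Theta> + 1) \<le> 1 - \<beta>"
    and below: "\<And>w. Fmin \<le> obj w"
  shows "(1 - \<beta>) / 4 * (\<Sum>t=1..T. \<eta> t * (norm (gradient obj (smg_iterate n f \<beta> \<eta> \<pi> w0 (t - 1))))\<^sup>2)
    \<le> obj w0 - Fmin + 9 / 8 * \<kappa> * \<sigma>\<^sup>2 * (\<Sum>t=1..T. \<eta> t)"
proof -
  define w where "w t = fst (smg_epoch n f \<beta> \<eta> \<pi> w0 t)" for t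
  define m where "m t = snd (smg_epoch n f \<beta> \<eta> \<pi> w0 t)" for t
  define q where "q t = (case t of 0 \<Rightarrow> 0
    | Suc s \<Rightarrow> smg_mean_sq n f \<beta> (\<eta> t) (\<pi> t) (w s) (m s))" for t
  define e where "e t = (case t of 0 \<Rightarrow> 0 | Suc s \<Rightarrow> \<beta> * q s + (1 - \<beta>) * q t)" for t
  define G where "G t = (norm (gradient obj (w t)))\<^sup>2" for t
  have q_nonneg: "0 \<le> q t" for t
    by (simp add: q_def smg_mean_sq_nonneg split: nat.split)
  have e_nonneg: "0 \<le> e t" for t
    using q_nonneg beta by (simp add: e_def split: nat.split)
  have w_Suc: "w (Suc t) = fst (smg_inner n f \<beta> (\<eta> (Suc t)) (\<pi> (Suc t)) (w t) (m t) n)"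
    and m_Suc: "m (Suc t) = snd (smg_inner n f \<beta> (\<eta> (Suc t)) (\<pi> (Suc t)) (w t) (m t) n)" for t
    by (simp_all add: w_def m_def split_beta Let_def)
  have m_le: "(norm (m t))\<^sup>2 \<le> q t" for t
  proof (cases t)
    case 0
    then show ?thesis by (simp add: m_def q_def)
  next
    case (Suc s)
    then show ?thesis by (simp add: m_Suc q_def smg_momentum_bound)
  qed
  have spread: "L\<^sup>2 * ((\<eta> (Suc t))\<^sup>2 * (\<beta> * (norm (m t))\<^sup>2
      + (1 - \<beta>) * smg_mean_sq n f \<beta> (\<eta> (Suc t)) (\<pi> (Suc t)) (w t) (m t))) \<le> \<kappa> * e (Suc t)"
    (is "L\<^sup>2 * (_ * ?s) \<le> _") if "t < T" for t
  proof -
    have "L\<^sup>2 * ((\<eta> (Suc t))\<^sup>2 * ?s) = (L * \<eta> (Suc t))\<^sup>2 * ?s"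
      by (simp add: power_mult_distrib)
    also have "\<dots> \<le> \<kappa> * e (Suc t)"
    proof (rule mult_mono)
      show "(L * \<eta> (Suc t))\<^sup>2 \<le> \<kappa>" using eta_le[of "Suc t"] that by simp
      show "?s \<le> e (Suc t)" using m_le[of t] beta by (simp add: e_def q_def mult_left_mono)
      show "0 \<le> ?s" using beta smg_mean_sq_nonneg by (intro add_nonneg_nonneg mult_nonneg_nonneg) auto
    qed (rule kappa)
    finally show ?thesis .
  qed
  have perm': "\<pi> (Suc t) permutes {1..n}" if "t < T" for t
    using perm that by simp
  have err_out: "(norm (gradient obj (w t) - m (Suc t)))\<^sup>2 \<le> \<kappa> * e (Suc t)" if "t < T" for t
    using momentum_error[OF perm'[OF that] beta(1), of 0 "\<eta> (Suc t)" "w t" "m t"]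
      spread[OF that] beta by (simp add: m_Suc)
  have err_in: "(norm (gradient obj (w (Suc t)) - m (Suc t)))\<^sup>2 \<le> \<kappa> * e (Suc t)" if "t < T" for t
    using momentum_error[OF perm'[OF that] beta(1), of n "\<eta> (Suc t)" "w t" "m t"]
      spread[OF that] beta by (simp add: m_Suc w_Suc)
  have grow: "q (Suc t) \<le> 2 * \<kappa> * e (Suc t) + 2 * ((\<Theta> + 1) * G t + \<sigma>\<^sup>2)" if "t < T" for t
    using mean_sq_bound[OF perm'[OF that] beta(1), of "\<eta> (Suc t)" "w t" "m t"]
      spread[OF that] beta by (simp add: q_def G_def)
  have step: "w (Suc t) = w t + (- \<eta> (Suc t)) *\<^sub>R (\<beta> *\<^sub>R m t + (1 - \<beta>) *\<^sub>R m (Suc t))" for t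
    unfolding w_Suc m_Suc by (rule smg_epoch_step[OF n_pos])
  have descent: "obj (w (Suc t)) \<le> obj (w t) - (1 - \<beta>) / 2 * (\<eta> (Suc t) * G t)
      + \<kappa> / 2 * (\<eta> (Suc t) * (\<beta> * e t + (1 - \<beta>) * e (Suc t)))" if "t < T" for t
  proof -
    let ?h = "\<eta> (Suc t)"
    have h: "0 \<le> ?h" using eta that by simp
    have "18 * \<kappa> * 1 \<le> 18 * \<kappa> * (\<Theta> + 1)" using kappa Theta by (intro mult_left_mono) auto
    then have "(L * ?h)\<^sup>2 \<le> 1\<^sup>2" using eta_le[of "Suc t"] that kappa beta by simp
    then have Lh: "L * ?h \<le> 1" by (rule power2_le_imp_le) simp
    show ?thesis
    proof (cases t)
      case 0
      \<comment> \<open>As \<open>m 0 = 0\<close>, the epoch is a step of length \<open>(1 - \<beta>) h\<close> along \<open>m 1\<close>.\<close>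
      have "L * (?h * (1 - \<beta>)) \<le> 1"
        using mult_mono[OF Lh, of "1 - \<beta>" 1] beta by (simp add: mult.assoc)
      then have "obj (w t + (- (?h * (1 - \<beta>))) *\<^sub>R m (Suc t))
          \<le> obj (w t) - (?h * (1 - \<beta>)) / 2 * G t
            + (?h * (1 - \<beta>)) / 2 * (norm (gradient obj (w t) - m (Suc t)))\<^sup>2"
        unfolding G_def using h beta by (intro gradient_step_descent) auto
      also have "\<dots> \<le> obj (w t) - (?h * (1 - \<beta>)) / 2 * G t + (?h * (1 - \<beta>)) / 2 * (\<kappa> * e (Suc t))"
        using h beta err_out[OF that] by (intro add_left_mono mult_left_mono) auto
      also have "w t + (- (?h * (1 - \<beta>))) *\<^sub>R m (Suc t) = w (Suc t)"
      proof -
        have "m t = 0" using 0 by (simp add: m_def)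
        then show ?thesis by (simp add: step[of t])
      qed
      moreover have "e t = 0" using 0 by (simp add: e_def)
      ultimately show ?thesis
        by (simp add: algebra_simps add_divide_distrib diff_divide_distrib)
    next
      case (Suc s)
      let ?d = "\<beta> *\<^sub>R m t + (1 - \<beta>) *\<^sub>R m (Suc t)"
      have "gradient obj (w t) - ?d
          = \<beta> *\<^sub>R (gradient obj (w t) - m t) + (1 - \<beta>) *\<^sub>R (gradient obj (w t) - m (Suc t))"
        by (simp add: algebra_simps)
      then have "(norm (gradient obj (w t) - ?d))\<^sup>2
          \<le> \<beta> * (norm (gradient obj (w t) - m t))\<^sup>2 + (1 - \<beta>) * (norm (gradient obj (w t) - m (Suc t)))\<^sup>2"
        using norm_convex_combination_squared_le beta by (metis less_imp_le)
      also have "\<dots> \<le> \<beta> * (\<kappa> * e t) + (1 - \<beta>) * (\<kappa> * e (Suc t))"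
        using err_in[of s] err_out[OF that] that Suc beta by (intro add_mono mult_left_mono) auto
      finally have err: "(norm (gradient obj (w t) - ?d))\<^sup>2
          \<le> \<kappa> * (\<beta> * e t + (1 - \<beta>) * e (Suc t))" (is "_ \<le> ?r")
        by (simp add: algebra_simps)
      have "obj (w (Suc t)) \<le> obj (w t) - ?h / 2 * G t + ?h / 2 * (norm (gradient obj (w t) - ?d))\<^sup>2"
        unfolding step G_def by (rule gradient_step_descent[OF h Lh])
      also have "\<dots> \<le> obj (w t) - (1 - \<beta>) * (?h / 2 * G t) + ?h / 2 * ?r"
      proof -
        have "(1 - \<beta>) * (?h / 2 * G t) \<le> 1 * (?h / 2 * G t)"
          using h beta by (intro mult_right_mono) (auto simp: G_def)
        moreover have "?h / 2 * (norm (gradient obj (w t) - ?d))\<^sup>2 \<le> ?h / 2 * ?r"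
          using h err by (intro mult_left_mono) auto
        ultimately show ?thesis by simp
      qed
      finally show ?thesis by (simp add: algebra_simps)
    qed
  qed
  have "(1 - \<beta>) / 4 * (\<Sum>t<T. \<eta> (Suc t) * G t)
      \<le> obj (w 0) - obj (w T) + 9 / 8 * \<kappa> * \<sigma>\<^sup>2 * (\<Sum>t<T. \<eta> (Suc t))"
  proof (rule descent_recursion_sum[where q = q and e = e])
    show "\<eta> (Suc (Suc t)) \<le> \<eta> (Suc t)" if "Suc t < T" for t
      using eta_anti[of "Suc t"] that by simp
    show "q 0 = 0" "e 0 = 0" "\<And>t. e (Suc t) = \<beta> * q t + (1 - \<beta>) * q (Suc t)"
      by (simp_all add: q_def e_def)
  qed (use eta beta Theta kappa descent grow q_nonneg in \<open>auto simp: G_def\<close>)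
  also have "obj (w 0) - obj (w T) \<le> obj w0 - Fmin"
    using below[of "w T"] by (simp add: w_def)
  finally show ?thesis
    by (simp add: sum.atLeast1_atMost_eq G_def w_def smg_iterate_def)
qed

end

section \<open>Averaging over the random output index\<close>

lemma (in prob_space) indep_var_vimage_algebra:
  assumes "indep_set (sets (vimage_algebra (space M) X A)) (sets (vimage_algebra (space M) Y B))"
    and X: "X \<in> measurable M A" and Y: "Y \<in> measurable M B"
    and U: "U \<in> measurable (vimage_algebra (space M) X A) S"
    and V: "V \<in> measurable (vimage_algebra (space M) Y B) T"
  shows "indep_var S U T V"
proof -
  have sub: "sigma_sets (space M) {U -` C \<inter> space M | C. C \<in> sets S} \<subseteq> sets (vimage_algebra (space M) X A)"
    if "U \<in> measurable (vimage_algebra (space M) X A) S"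
    for U and X :: "'a \<Rightarrow> 'x" and A S
  proof -
    have "{U -` C \<inter> space M | C. C \<in> sets S} \<subseteq> sets (vimage_algebra (space M) X A)"
      using measurable_sets[OF that] by auto
    from sets.sigma_sets_subset[OF this] show ?thesis by simp
  qed
  have le: "sets (vimage_algebra (space M) X A) \<subseteq> sets M" if "X \<in> measurable M A"
    for X :: "'a \<Rightarrow> 'x" and A
    using that by (simp add: measurable_iff_sets)
  have meas: "U \<in> measurable M S" if "X \<in> measurable M A"
    "U \<in> measurable (vimage_algebra (space M) X A) S" for U and X :: "'a \<Rightarrow> 'x" and A S
    using that(2) le[OF that(1)] unfolding measurable_def by auto
  show ?thesis
    unfolding indep_var_eq
  proof (intro conjI)
    show "indep_set (sigma_sets (space M) {U -` C \<inter> space M | C. C \<in> sets S})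
      (sigma_sets (space M) {V -` C \<inter> space M | C. C \<in> sets T})"
      using assms(1) sub[OF U] sub[OF V]
      unfolding indep_set_def by (elim indep_sets_mono_sets) (auto split: bool.split)
  qed (rule meas[OF X U], rule meas[OF Y V])
qed

text \<open>The expectation at an independent random index taking values in a finite set is the mixture of
  the expectations at the fixed indices.\<close>

lemma (in prob_space) expectation_independent_index:
  fixes h :: "'i \<Rightarrow> 'z \<Rightarrow> real"
  assumes I: "finite I" and tau: "\<tau> \<in> measurable M (count_space I)" and Z: "Z \<in> measurable M N"
    and indep: "indep_set (sets (vimage_algebra (space M) \<tau> (count_space I)))
      (sets (vimage_algebra (space M) Z N))"
    and h: "\<And>t. t \<in> I \<Longrightarrow> h t \<in> borel_measurable N"
    and int: "\<And>t. t \<in> I \<Longrightarrow> integrable M (\<lambda>\<omega>. h t (Z \<omega>))"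
  shows "expectation (\<lambda>\<omega>. h (\<tau> \<omega>) (Z \<omega>))
    = (\<Sum>t\<in>I. prob {\<omega> \<in> space M. \<tau> \<omega> = t} * expectation (\<lambda>\<omega>. h t (Z \<omega>)))"
proof -
  have ind: "indep_var borel (\<lambda>\<omega>. indicator {t} (\<tau> \<omega>) :: real) borel (\<lambda>\<omega>. h t (Z \<omega>))"
    if "t \<in> I" for t
  proof (rule indep_var_vimage_algebra[OF indep tau Z])
    show "(\<lambda>\<omega>. indicator {t} (\<tau> \<omega>) :: real) \<in> borel_measurable (vimage_algebra (space M) \<tau> (count_space I))"
      using tau by (intro measurable_compose[OF measurable_vimage_algebra1])
        (auto dest: measurable_space)
    show "(\<lambda>\<omega>. h t (Z \<omega>)) \<in> borel_measurable (vimage_algebra (space M) Z N)"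
      using Z h[OF that] by (intro measurable_compose[OF measurable_vimage_algebra1])
        (auto dest: measurable_space)
  qed
  have set: "{\<omega> \<in> space M. \<tau> \<omega> = t} \<in> sets M" if "t \<in> I" for t
    using measurable_sets[OF tau, of "{t}"] that by (auto simp: vimage_def Int_def conj_commute)
  have ind_eq: "(indicator {t} (\<tau> \<omega>) :: real) = indicator {\<omega> \<in> space M. \<tau> \<omega> = t} \<omega>"
    if "\<omega> \<in> space M" for \<omega> t
    using that by (simp add: indicator_def)
  have int_ind: "integrable M (\<lambda>\<omega>. indicator {t} (\<tau> \<omega>) :: real)" if "t \<in> I" for t
    using set[OF that] by (simp add: ind_eq less_top[symmetric] cong: Bochner_Integration.integrable_cong)
  have exp_ind: "expectation (\<lambda>\<omega>. indicator {t} (\<tau> \<omega>)) = prob {\<omega> \<in> space M. \<tau> \<omega> = t}"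
    if "t \<in> I" for t
    using set[OF that] by (simp add: ind_eq cong: Bochner_Integration.integral_cong)
  have "expectation (\<lambda>\<omega>. h (\<tau> \<omega>) (Z \<omega>))
      = expectation (\<lambda>\<omega>. \<Sum>t\<in>I. indicator {t} (\<tau> \<omega>) * h t (Z \<omega>))"
  proof (rule Bochner_Integration.integral_cong)
    fix \<omega> assume "\<omega> \<in> space M"
    then have "\<tau> \<omega> \<in> I" using measurable_space[OF tau] by simp
    then show "h (\<tau> \<omega>) (Z \<omega>) = (\<Sum>t\<in>I. indicator {t} (\<tau> \<omega>) * h t (Z \<omega>))"
      using I by (simp add: indicator_def if_distrib[of "\<lambda>x. x * _"] cong: if_cong)
  qed simp
  also have "\<dots> = (\<Sum>t\<in>I. expectation (\<lambda>\<omega>. indicator {t} (\<tau> \<omega>) * h t (Z \<omega>)))"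
    by (intro Bochner_Integration.integral_sum indep_var_integrable ind int_ind int)
  also have "\<dots> = (\<Sum>t\<in>I. prob {\<omega> \<in> space M. \<tau> \<omega> = t} * expectation (\<lambda>\<omega>. h t (Z \<omega>)))"
    by (intro sum.cong refl)
      (simp add: indep_var_lebesgue_integral[OF ind int_ind int] exp_ind)
  finally show ?thesis .
qed

lemma smg_epoch_cong:
  assumes "\<And>s. s \<in> {1..t} \<Longrightarrow> \<pi> s = \<pi>' s"
  shows "smg_epoch n f \<beta> \<eta> \<pi> w0 t = smg_epoch n f \<beta> \<eta> \<pi>' w0 t"
  using assms by (induction t) auto


text \<open>There are only finitely many sequences of permutations, so every function of them is measurable
  and bounded.\<close>

lemma PiM_permutation_space:
  fixes T :: nat
  shows "Pi\<^sub>M {1..T} (\<lambda>t. permutation_space n)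
    = count_space ({1..T} \<rightarrow>\<^sub>E {p. p permutes {1..n}})"
  by (rule count_space_PiM_finite) (simp_all add: countable_finite finite_permutations)

lemma (in finite_measure) integrable_compose_count_space:
  fixes g :: "'z \<Rightarrow> real"
  assumes Z: "Z \<in> measurable M (count_space A)" and "finite A"
  shows "integrable M (\<lambda>\<omega>. g (Z \<omega>))"
proof (rule integrable_const_bound[where B = "\<Sum>z\<in>A. \<bar>g z\<bar>"])
  show "AE \<omega> in M. norm (g (Z \<omega>)) \<le> (\<Sum>z\<in>A. \<bar>g z\<bar>)"
    using measurable_space[OF Z] \<open>finite A\<close>
    by (auto intro!: AE_I2 member_le_sum[of _ A "\<lambda>z. \<bar>g z\<bar>"])
  show "(\<lambda>\<omega>. g (Z \<omega>)) \<in> borel_measurable M"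
    using Z by (rule measurable_compose) simp
qed

section \<open>The exponential learning rate\<close>

lemma exp_rate_antimono:
  assumes "0 < \<gamma>" "0 \<le> \<alpha>" "\<alpha> \<le> 1" "s \<le> t"
  shows "exp_rate \<gamma> \<alpha> T t \<le> exp_rate \<gamma> \<alpha> T s"
  using assms unfolding exp_rate_def by (intro divide_right_mono mult_left_mono power_decreasing) auto

lemma sum_exp_rate_ge:
  assumes "0 < \<gamma>" "0 \<le> \<alpha>" "\<alpha> \<le> 1" "1 \<le> T"
  shows "\<gamma> * \<alpha> ^ T * real T powr (2 / 3) \<le> (\<Sum>t=1..T. exp_rate \<gamma> \<alpha> T t)"
proof -
  have "real T powr (1 / 3) * real T powr (2 / 3) = real T"
    using assms by (simp flip: powr_add)
  then have "\<gamma> * \<alpha> ^ T * real T powr (2 / 3) = (\<Sum>t=1..T. exp_rate \<gamma> \<alpha> T T)"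
    using assms by (simp add: exp_rate_def field_simps)
  also have "\<dots> \<le> (\<Sum>t=1..T. exp_rate \<gamma> \<alpha> T t)"
    using assms by (intro sum_mono exp_rate_antimono) auto
  finally show ?thesis .
qed

lemma exp_rate_squared_le:
  assumes "0 < \<gamma>" "0 \<le> \<alpha>" "\<alpha> \<le> 1"
  shows "(exp_rate \<gamma> \<alpha> T t)\<^sup>2 \<le> \<gamma>\<^sup>2 / real T powr (2 / 3)"
proof -
  have "(exp_rate \<gamma> \<alpha> T t)\<^sup>2 = \<gamma>\<^sup>2 * (\<alpha> ^ t)\<^sup>2 / real T powr (2 / 3)"
    unfolding exp_rate_def power_divide power_mult_distrib
    by (simp add: power2_eq_square flip: powr_add)
  also have "\<dots> \<le> \<gamma>\<^sup>2 * 1 / real T powr (2 / 3)"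
    using assms by (intro divide_right_mono mult_left_mono power_le_one zero_le_power) auto
  finally show ?thesis by simp
qed

text \<open>The step size condition makes \<open>(L \<eta>)\<^sup>2\<close> small against \<open>(1 - \<beta>) / (\<Theta> + 1)\<close>; the second term
  in the maximum defining \<open>smg_K\<close> is used, together with \<open>5 - 3 \<beta> \<ge> 2\<close>.\<close>

lemma step_size_bound:
  assumes "0 < L" "0 \<le> \<beta>" "\<beta> < 1" "0 \<le> \<Theta>"
    and "0 < \<eta>" "\<eta> \<le> 1 / (L * sqrt (smg_K \<beta> \<Theta>))"
  shows "18 * (L * \<eta>)\<^sup>2 * (\<Theta> + 1) \<le> 1 - \<beta>"
proof -
  define K where "K = smg_K \<beta> \<Theta>"
  have "0 < K" unfolding K_def smg_K_def by (simp add: less_max_iff_disj)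
  then have "L * \<eta> * sqrt K \<le> 1"
    using assms by (simp add: K_def field_simps)
  then have "(L * \<eta> * sqrt K)\<^sup>2 \<le> 1\<^sup>2"
    using assms \<open>0 < K\<close> by (intro power_mono) auto
  then have K: "(L * \<eta>)\<^sup>2 * K \<le> 1"
    using \<open>0 < K\<close> by (simp add: power_mult_distrib)
  have "18 * (\<Theta> + 1) \<le> 9 * (5 - 3 * \<beta>) * (\<Theta> + 1)"
    using assms by (intro mult_right_mono) auto
  also have "\<dots> = (1 - \<beta>) * (9 * (5 - 3 * \<beta>) * (\<Theta> + 1) / (1 - \<beta>))"
    using assms by simp
  also have "\<dots> \<le> (1 - \<beta>) * K"
    using assms unfolding K_def smg_K_def by (intro mult_left_mono) auto
  finally have "(L * \<eta>)\<^sup>2 * (18 * (\<Theta> + 1)) \<le> (L * \<eta>)\<^sup>2 * ((1 - \<beta>) * K)"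
    by (rule mult_left_mono) simp
  also have "\<dots> = (1 - \<beta>) * ((L * \<eta>)\<^sup>2 * K)" by (simp add: mult_ac)
  also have "\<dots> \<le> (1 - \<beta>) * 1" using K assms by (intro mult_left_mono) auto
  finally show ?thesis by (simp only: mult_ac mult_1)
qed

section \<open>The convergence rate\<close>

theorem corollary3:
  fixes f :: "real ^ 'd \<Rightarrow> nat \<Rightarrow> real"
    and n T :: nat
    and L \<Theta> \<sigma> \<beta> \<gamma> \<rho> \<alpha> :: real
    and \<eta> :: "nat \<Rightarrow> real"
    and F :: "real ^ 'd \<Rightarrow> real"
    and w0 :: "real ^ 'd"
    and M :: "'o measure"
    and \<pi> :: "nat \<Rightarrow> 'o \<Rightarrow> nat \<Rightarrow> nat"
    and \<tau> :: "'o \<Rightarrow> nat"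
  assumes "n \<ge> 1"
    and "F = objective n f"
    and "\<And>i w. i \<in> {1..n} \<Longrightarrow> (\<lambda>x. f x i) differentiable (at w)"
    and "bdd_below (range F)"
    and "L > 0"
    and "\<And>i w w'. i \<in> {1..n} \<Longrightarrow>
           norm (gradient (\<lambda>x. f x i) w - gradient (\<lambda>x. f x i) w') \<le> L * norm (w - w')"
    and "\<Theta> \<ge> 0" and "\<sigma> \<ge> 0"
    and "\<And>w. (1 / real n) * (\<Sum>i=1..n. (norm (gradient (\<lambda>x. f x i) w - gradient F w))\<^sup>2)
           \<le> \<Theta> * (norm (gradient F w))\<^sup>2 + \<sigma>\<^sup>2"
    and "0 \<le> \<beta>" and "\<beta> < 1"
    and "T \<ge> 1"
    and "\<gamma> > 0" and "\<rho> > 0"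
    and "\<alpha> = \<rho> powr (1 / real T)" and "0 < \<alpha>" and "\<alpha> < 1"
    and "\<eta> = exp_rate \<gamma> \<alpha> T"
    and "\<And>t. t \<in> {1..T} \<Longrightarrow> 0 < \<eta> t \<and> \<eta> t \<le> 1 / (L * sqrt (smg_K \<beta> \<Theta>))"
    and "prob_space M"
    and "\<And>t. t \<in> {1..T} \<Longrightarrow> \<pi> t \<in> measurable M (permutation_space n)"
    and "\<tau> \<in> measurable M (count_space {1..T})"
    and "\<And>t. t \<in> {1..T} \<Longrightarrow>
           measure M {\<omega> \<in> space M. \<tau> \<omega> = t} = \<eta> t / (\<Sum>s=1..T. \<eta> s)"
    and "prob_space.indep_set M
           (sets (vimage_algebra (space M) \<tau> (count_space {1..T})))
           (sets (vimage_algebra (space M) (\<lambda>\<omega>. \<lambda>t\<in>{1..T}. \<pi> t \<omega>)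
              (Pi\<^sub>M {1..T} (\<lambda>t. permutation_space n))))"
  shows "prob_space.expectation M
           (\<lambda>\<omega>. (norm (gradient F (smg_iterate n f \<beta> \<eta> (\<lambda>t. \<pi> t \<omega>) w0 (\<tau> \<omega> - 1))))\<^sup>2)
         \<le> 4 * (F w0 - (INF w. F w)) / ((1 - \<beta>) * \<gamma> * \<rho> * real T powr (2 / 3))
           + 9 * \<sigma>\<^sup>2 * L\<^sup>2 * (5 - 3 * \<beta>) * \<gamma>\<^sup>2 / ((1 - \<beta>) * \<rho> * real T powr (2 / 3))"
proof -
  interpret prob_space M by fact
  interpret smooth_finite_sum n f L \<Theta> \<sigma>
    by unfold_locales (use assms(1,3,6,9) in \<open>auto simp: assms(2)\<close>)
  note beta = \<open>0 \<le> \<beta>\<close> \<open>\<beta> < 1\<close>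
  define Fmin where "Fmin = (INF w. F w)"
  have below: "Fmin \<le> F w" for w
    unfolding Fmin_def using assms(4) by (rule cINF_lower) simp
  define H where "H = (\<Sum>t=1..T. \<eta> t)"
  define \<kappa> where "\<kappa> = (L * \<eta> 1)\<^sup>2"
  define R where "R = real T powr (2 / 3)"
  have R: "0 < R" unfolding R_def using \<open>T \<ge> 1\<close> by simp
  have eta: "0 < \<eta> t" if "t \<in> {1..T}" for t using assms(19) that by blast
  have eta_anti: "\<eta> t \<le> \<eta> s" if "s \<le> t" for s t
    unfolding \<open>\<eta> = exp_rate \<gamma> \<alpha> T\<close> using that assms(13,16,17) by (intro exp_rate_antimono) auto
  have rho: "\<alpha> ^ T = \<rho>"
    using \<open>T \<ge> 1\<close> \<open>\<rho> > 0\<close> \<open>0 < \<alpha>\<close> unfolding \<open>\<alpha> = \<rho> powr (1 / real T)\<close>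
    by (simp add: powr_powr flip: powr_realpow)
  then have rho_le: "\<rho> \<le> 1" using \<open>0 < \<alpha>\<close> \<open>\<alpha> < 1\<close> by (auto intro: power_le_one)
  have H_ge: "\<gamma> * \<rho> * R \<le> H"
    using sum_exp_rate_ge[of \<gamma> \<alpha> T] assms(12,13,16,17) rho
    unfolding H_def R_def \<open>\<eta> = exp_rate \<gamma> \<alpha> T\<close> by simp
  have H: "0 < \<gamma> * \<rho> * R" "0 < H"
    using R \<open>\<gamma> > 0\<close> \<open>\<rho> > 0\<close> H_ge by (simp, smt (verit) mult_pos_pos)
  have kappa_le: "\<kappa> \<le> L\<^sup>2 * \<gamma>\<^sup>2 / R"
  proof -
    have "(\<eta> 1)\<^sup>2 \<le> \<gamma>\<^sup>2 / R"
      unfolding R_def \<open>\<eta> = exp_rate \<gamma> \<alpha> T\<close> using assms(13,16,17)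
      by (intro exp_rate_squared_le) auto
    then have "L\<^sup>2 * (\<eta> 1)\<^sup>2 \<le> L\<^sup>2 * (\<gamma>\<^sup>2 / R)" by (rule mult_left_mono) simp
    then show ?thesis by (simp add: \<kappa>_def power_mult_distrib)
  qed

  define Z where "Z \<omega> = (\<lambda>t\<in>{1..T}. \<pi> t \<omega>)" for \<omega>
  define h where "h t p = (norm (gradient F (smg_iterate n f \<beta> \<eta> p w0 (t - 1))))\<^sup>2" for t p
  have h_Z: "h t (\<lambda>t. \<pi> t \<omega>) = h t (Z \<omega>)" if "t \<in> {1..T}" for t \<omega>
  proof -
    have "smg_epoch n f \<beta> \<eta> (\<lambda>t. \<pi> t \<omega>) w0 (t - 1) = smg_epoch n f \<beta> \<eta> (Z \<omega>) w0 (t - 1)"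
      using that by (intro smg_epoch_cong) (auto simp: Z_def)
    then show ?thesis by (simp add: h_def smg_iterate_def)
  qed
  have Z: "Z \<in> measurable M (Pi\<^sub>M {1..T} (\<lambda>t. permutation_space n))"
    unfolding Z_def[abs_def] by (intro measurable_restrict assms(21))
  have tau: "\<tau> \<omega> \<in> {1..T}" if "\<omega> \<in> space M" for \<omega>
    using measurable_space[OF assms(22) that] by simp
  have int: "integrable M (\<lambda>\<omega>. h t (Z \<omega>))" for t
    by (rule integrable_compose_count_space[OF Z[unfolded PiM_permutation_space]])
      (intro finite_PiE finite_permutations finite_atLeastAtMost)

  have path: "(\<Sum>t=1..T. \<eta> t * h t (Z \<omega>)) \<le> 4 / (1 - \<beta>) * (F w0 - Fmin + 9 / 8 * \<kappa> * \<sigma>\<^sup>2 * H)"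
    if "\<omega> \<in> space M" for \<omega>
  proof -
    have "Z \<omega> t permutes {1..n}" if "t \<in> {1..T}" for t
      using measurable_space[OF assms(21)[OF that] \<open>\<omega> \<in> space M\<close>] that by (simp add: Z_def)
    moreover have "(L * \<eta> t)\<^sup>2 \<le> \<kappa>" if "t \<in> {1..T}" for t
      unfolding \<kappa>_def using that eta[OF that] eta_anti[of 1 t] \<open>L > 0\<close>
      by (intro power_mono mult_left_mono) auto
    moreover have "18 * \<kappa> * (\<Theta> + 1) \<le> 1 - \<beta>"
      unfolding \<kappa>_def using assms(19)[of 1] \<open>T \<ge> 1\<close> assms(5,7,10,11)
      by (intro step_size_bound) auto
    ultimately have "(1 - \<beta>) / 4 * (\<Sum>t=1..T. \<eta> t * h t (Z \<omega>))
        \<le> F w0 - Fmin + 9 / 8 * \<kappa> * \<sigma>\<^sup>2 * H"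
      unfolding h_def H_def assms(2)
      by (intro weighted_gradient_sum beta \<open>\<Theta> \<ge> 0\<close> below[unfolded assms(2)] eta_anti less_imp_le[OF eta])
        (auto simp: \<kappa>_def)
    then show ?thesis using beta by (simp add: field_simps)
  qed

  have "expectation (\<lambda>\<omega>. h (\<tau> \<omega>) (\<lambda>t. \<pi> t \<omega>)) = expectation (\<lambda>\<omega>. h (\<tau> \<omega>) (Z \<omega>))"
    by (intro Bochner_Integration.integral_cong refl h_Z tau)
  also have "\<dots> = (\<Sum>t=1..T. prob {\<omega> \<in> space M. \<tau> \<omega> = t} * expectation (\<lambda>\<omega>. h t (Z \<omega>)))"
  proof (rule expectation_independent_index[OF _ assms(22) Z])
    show "indep_set (sets (vimage_algebra (space M) \<tau> (count_space {1..T})))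
        (sets (vimage_algebra (space M) Z (Pi\<^sub>M {1..T} (\<lambda>t. permutation_space n))))"
      using assms(24) unfolding Z_def[abs_def] .
    show "h t \<in> borel_measurable (Pi\<^sub>M {1..T} (\<lambda>t. permutation_space n))" for t
      unfolding PiM_permutation_space by simp
  qed (use int in auto)
  also have "\<dots> = (\<Sum>t=1..T. \<eta> t / H * expectation (\<lambda>\<omega>. h t (Z \<omega>)))"
    by (intro sum.cong refl) (simp add: assms(23) H_def)
  also have "\<dots> = expectation (\<lambda>\<omega>. \<Sum>t=1..T. \<eta> t * h t (Z \<omega>)) / H"
    using int by (simp add: sum_divide_distrib)
  also have "\<dots> \<le> (4 / (1 - \<beta>) * (F w0 - Fmin + 9 / 8 * \<kappa> * \<sigma>\<^sup>2 * H)) / H"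
    using H path int by (intro divide_right_mono integral_le_const) auto
  also have "\<dots> = 4 * (F w0 - Fmin) / ((1 - \<beta>) * H) + 9 / 2 * \<kappa> * \<sigma>\<^sup>2 / (1 - \<beta>)"
  proof -
    have "(4 / b * (D + 9 / 8 * k * H)) / H = 4 * D / (b * H) + 9 / 2 * k / b"
      if "b \<noteq> 0" for b D k :: real
      using H(2) that by (simp add: field_simps)
    from this[of "1 - \<beta>" "F w0 - Fmin" "\<kappa> * \<sigma>\<^sup>2"] show ?thesis
      using beta by (simp add: mult.assoc)
  qed
  also have "\<dots> \<le> 4 * (F w0 - Fmin) / ((1 - \<beta>) * \<gamma> * \<rho> * R)
      + 9 * \<sigma>\<^sup>2 * L\<^sup>2 * (5 - 3 * \<beta>) * \<gamma>\<^sup>2 / ((1 - \<beta>) * \<rho> * R)"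
  proof (rule add_mono)
    have "(1 - \<beta>) * (\<gamma> * \<rho> * R) \<le> (1 - \<beta>) * H" using H_ge beta by (intro mult_left_mono) auto
    then show "4 * (F w0 - Fmin) / ((1 - \<beta>) * H) \<le> 4 * (F w0 - Fmin) / ((1 - \<beta>) * \<gamma> * \<rho> * R)"
      using below[of w0] beta H by (intro divide_left_mono) (auto simp: mult.assoc)
    define A where "A = \<sigma>\<^sup>2 * (L\<^sup>2 * \<gamma>\<^sup>2 / R) / (1 - \<beta>)"
    have A: "0 \<le> A" unfolding A_def using R beta by simp
    have "9 / 2 * \<kappa> * \<sigma>\<^sup>2 / (1 - \<beta>) = 9 / 2 * (\<sigma>\<^sup>2 * \<kappa> / (1 - \<beta>))" by simp
    also have "\<dots> \<le> 9 / 2 * A"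
      unfolding A_def using kappa_le beta by (intro mult_left_mono divide_right_mono) auto
    also have "\<dots> \<le> 9 * (5 - 3 * \<beta>) / \<rho> * A"
    proof (rule mult_right_mono[OF _ A])
      have "9 / 2 * \<rho> \<le> 9 / 2 * 1" using rho_le by simp
      also have "\<dots> \<le> 9 * (5 - 3 * \<beta>)" using beta by simp
      finally show "9 / 2 \<le> 9 * (5 - 3 * \<beta>) / \<rho>" using \<open>\<rho> > 0\<close> by (simp add: pos_le_divide_eq)
    qed
    also have "\<dots> = 9 * \<sigma>\<^sup>2 * L\<^sup>2 * (5 - 3 * \<beta>) * \<gamma>\<^sup>2 / ((1 - \<beta>) * \<rho> * R)"
      unfolding A_def by (simp add: mult_ac)
    finally show "9 / 2 * \<kappa> * \<sigma>\<^sup>2 / (1 - \<beta>) \<le> 9 * \<sigma>\<^sup>2 * L\<^sup>2 * (5 - 3 * \<beta>) * \<gamma>\<^sup>2 / ((1 - \<beta>) * \<rho> * R)" .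
  qed
  finally show ?thesis unfolding h_def Fmin_def R_def .
qed

end
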